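(* Let $p\geq 2$ and let $\sigma$ be the substitution on $\{-1,1\}$ given by $\sigma(1)=v_0v_1\cdots v_{p-1}$, $\sigma(-1)=\bar v_0\bar v_1\cdots\bar v_{p-1}$, where $v_0=1$, $v_i\in\{-1,1\}$ and $\bar v_i=-v_i$. Let $\mathbf{d}\in\{-1,1\}^{\infty}$ be the fixed point of $\sigma$ starting with $1$. For $m\geq p$ define $v_m:=v_j$ where $m=np+j$ with $n\geq 0$ and $0\leq j\leq p-1$. (1) If $p$ is odd, then $\mathbf{d}$ is apwenian if and only if \[\frac{v_j+v_{j+1}-v_{2j+1}-v_{2j+2}}{2}\equiv 1\pmod 2,\quad 0\leq j\leq p-2.\] (2) If $p$ is even, then $\mathbf{d}$ is apwenian if and only if $\mathbf{d}$ is the Thue-Morse sequence, i.e. $d_0=1$, $d_{2n}=d_n$ and $d_{2n+1}=-d_n$ for all $n\geq 0$.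
   Context: For an integer sequence $\mathbf{a}$, $H_n(\mathbf{a})=\det(a_{i+j})_{0\leq i,j\leq n-1}$. A sequence $\mathbf{d}\in\{-1,1\}^{\infty}$ is apwenian if $H_n(\mathbf{d})/2^{n-1}\equiv 1\pmod 2$ for all $n\geq 1$. *)

theory Defs
  imports
    "Jordan_Normal_Form.Determinant"
    "HOL-Library.Stream"
    "HOL-Number_Theory.Cong"
begin

definition hankel_det :: "(nat \<Rightarrow> int) \<Rightarrow> nat \<Rightarrow> int" where
  "hankel_det a n = det (mat n n (\<lambda>(i, j). a (i + j)))"

(* The division is exact: see pow2_dvd_hankel_det below. *)
definition apwenian :: "(nat \<Rightarrow> int) \<Rightarrow> bool" where
  "apwenian d \<longleftrightarrow>
     (\<forall>n. d n \<in> {-1, 1}) \<and> (\<forall>n\<ge>1. [hankel_det d n div 2 ^ (n - 1) = 1] (mod 2))"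

(* sigma(d) is the infinite concatenation sigma(d_0) sigma(d_1) sigma(d_2) ...  The stream function
   flat computes it only for non-erasing sigma; flat_constant_length below gives its letters when
   all the words have the same positive length. *)
definition fixed_point :: "('a \<Rightarrow> 'a list) \<Rightarrow> (nat \<Rightarrow> 'a) \<Rightarrow> bool" where
  "fixed_point \<sigma> d \<longleftrightarrow> flat (smap \<sigma> (smap d nats)) = smap d nats"

definition thue_morse :: "(nat \<Rightarrow> int) \<Rightarrow> bool" where
  "thue_morse d \<longleftrightarrow> d 0 = 1 \<and> (\<forall>n. d (2 * n) = d n \<and> d (2 * n + 1) = - d n)"

lemma flat_constant_length:
  assumes "0 < p" "\<forall>w\<in>sset ws. length w = p"
  shows "flat ws !! n = (ws !! (n div p)) ! (n mod p)"
  using assms(2)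
proof (induction n arbitrary: ws rule: less_induct)
  case (less n)
  have ne: "\<forall>w\<in>sset ws. w \<noteq> []" using less.prems \<open>0 < p\<close> by auto
  have len: "length (shd ws) = p" using less.prems by (simp add: shd_sset)
  show ?case
  proof (cases "n < p")
    case True
    then show ?thesis using flat_snth[OF ne, of n] len by simp
  next
    case False
    have "flat ws !! n = flat (stl ws) !! (n - p)"
      using flat_snth[OF ne, of n] len False by simp
    also have "\<dots> = (stl ws !! ((n - p) div p)) ! ((n - p) mod p)"
      using less.prems False \<open>0 < p\<close> by (intro less.IH) (auto dest: stl_sset)
    also have "\<dots> = (ws !! (n div p)) ! (n mod p)"
      using False \<open>0 < p\<close> by (simp add: le_div_geq le_mod_geq)
    finally show ?thesis .
  qed
qed

lemma pow2_dvd_hankel_det: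
  assumes "\<forall>n. d n \<in> {-1, 1}" "n \<ge> 1"
  shows "2 ^ (n - 1) dvd hankel_det d n"
proof -
  define A where "A = mat n n (\<lambda>(i, j). d (i + j))"
  define E :: "int mat" where
    "E = mat n n (\<lambda>(i, j). if i = j then 1 else if j = 0 then -1 else 0)"
  define D :: "int mat" where
    "D = mat n n (\<lambda>(i, j). if i = j then (if i = 0 then 1 else 2) else 0)"
  define B where
    "B = mat n n (\<lambda>(i, j). if i = 0 then d j else (d (i + j) - d j) div 2)"
  have carr: "A \<in> carrier_mat n n" "E \<in> carrier_mat n n" "D \<in> carrier_mat n n"
    "B \<in> carrier_mat n n"
    by (auto simp: A_def E_def D_def B_def)
  have even: "2 * ((d i - d j) div 2) = d i - d j" for i j
    using assms(1)[rule_format, of i] assms(1)[rule_format, of j] by auto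
  have EA: "(\<Sum>k = 0..<n. (if i = k then 1 else if k = 0 then -1 else 0) * d (k + j)) =
      (if i = 0 then d j else d (i + j) - d j)" if "i < n" for i j
  proof -
    have "(\<Sum>k = 0..<n. (if i = k then 1 else if k = 0 then -1 else 0) * d (k + j)) =
        (\<Sum>k = 0..<n. (if k = i then d (k + j) else 0)
          + (if k = 0 then (if i = 0 then 0 else - d (k + j)) else 0))"
      by (intro sum.cong) auto
    also have "\<dots> = (if i = 0 then d j else d (i + j) - d j)"
      using that by (simp add: sum.distrib)
    finally show ?thesis .
  qed
  have DB: "(\<Sum>k = 0..<n. (if i = k then (if i = 0 then 1 else 2) else 0) * b k) =
      (if i = 0 then 1 else 2) * b i" if "i < n" for i and b :: "nat \<Rightarrow> int"
  proof -
    have "(\<Sum>k = 0..<n. (if i = k then (if i = 0 then 1 else 2) else 0) * b k) =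
        (\<Sum>k = 0..<n. if k = i then (if i = 0 then 1 else 2) * b k else 0)"
      by (intro sum.cong) auto
    then show ?thesis using that by simp
  qed
  have "E * A = D * B"
  proof (rule eq_matI)
    fix i j assume "i < dim_row (D * B)" "j < dim_col (D * B)"
    then have ij: "i < n" "j < n" by (auto simp: D_def B_def)
    have "(E * A) $$ (i, j) =
        (\<Sum>k = 0..<n. (if i = k then 1 else if k = 0 then -1 else 0) * d (k + j))"
      using ij by (simp add: E_def A_def scalar_prod_def)
    moreover have "(D * B) $$ (i, j) =
        (\<Sum>k = 0..<n. (if i = k then (if i = 0 then 1 else 2) else 0) *
          (if k = 0 then d j else (d (k + j) - d j) div 2))"
      using ij by (simp add: D_def B_def scalar_prod_def)
    ultimately show "(E * A) $$ (i, j) = (D * B) $$ (i, j)"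
      using EA[OF ij(1), of j] DB[OF ij(1)] even by simp
  qed (simp_all add: E_def A_def D_def B_def)
  moreover have "det E = 1"
  proof -
    have "det E = prod_list (diag_mat E)"
      by (rule det_lower_triangular[OF _ carr(2)]) (auto simp: E_def)
    also have "diag_mat E = replicate n 1"
      by (rule nth_equalityI) (auto simp: diag_mat_def E_def)
    finally show ?thesis by simp
  qed
  moreover have "det D = 2 ^ (n - 1)"
  proof -
    have "det D = prod_list (diag_mat D)"
      by (rule det_lower_triangular[OF _ carr(3)]) (auto simp: D_def)
    also have "diag_mat D = 1 # replicate (n - 1) 2"
      using assms(2) by (intro nth_equalityI) (auto simp: diag_mat_def D_def nth_Cons split: nat.split)
    finally show ?thesis by simp
  qed
  ultimately have "det A = 2 ^ (n - 1) * det B"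
    using det_mult[OF carr(2,1)] det_mult[OF carr(3,4)] by simp
  then show ?thesis by (simp add: hankel_det_def A_def)
qed

end

theory Submission
  imports
    Defs
    "HOL-Library.Z2"
    "HOL-Computational_Algebra.Polynomial_FPS"
begin

text \<open>Put \<open>e k = (d k - d (k + 2)) / 2\<close> modulo 2. Row and column differences reduce
  \<open>H\<^sub>n(d) / 2\<^bsup>n-1\<^esup>\<close> modulo 2 to \<open>H\<^bsub>n-1\<^esub>(e)\<close>. Over the field with two elements, all Hankel
  determinants of \<open>e\<close> are nonzero iff \<open>e 0 = 1\<close> and \<open>e (2 k + 2) = e (2 k + 1) + e k\<close> (the
  characterization of perfect linear complexity profiles by Wang and Massey): under the recurrence
  a kernel vector would give a nontrivial zero of an anisotropic quadratic form, and conversely the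
  determinant of order \<open>n + 1\<close> is affine in \<open>e (2 n)\<close> with nonzero slope, so it forces the value
  of \<open>e (2 n)\<close>. In terms of \<open>d\<close> this says that \<open>d n * d (n + 1) * d (2 n + 1) * d (2 n + 2) = -1\<close>
  for all \<open>n\<close>. For odd \<open>p\<close> the positions \<open>2 n + 1\<close> and \<open>2 n + 2\<close> lie in one block of length \<open>p\<close>
  whenever \<open>n\<close> and \<open>n + 1\<close> do, and the remaining conditions reproduce those for smaller \<open>n\<close>. For
  even \<open>p\<close> the positions that straddle two blocks force \<open>d (2 m) * d (2 m + 1)\<close> to be constant,
  which leads to the Thue-Morse sequence.\<close>

declare add_bit_eq_xor [simp del] mult_bit_eq_and [simp del]

subsection \<open>Power series in prime characteristic\<close>

lemma CHAR_bit [simp]: "CHAR(bit) = 2"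
proof (rule CHAR_eq_posI)
  show "of_nat n \<noteq> (0 :: bit)" if "0 < n" "n < 2" for n
    using that by (cases "n = 1") auto
qed simp_all

lemma fps_nth_power_CHAR:
  fixes f :: "'a :: comm_semiring_1 fps"
  assumes "prime CHAR('a)"
  shows "fps_nth (f ^ CHAR('a)) m =
    (if CHAR('a) dvd m then fps_nth f (m div CHAR('a)) ^ CHAR('a) else 0)"
proof -
  let ?p = "CHAR('a)"
  define g where "g = (\<Sum>i\<le>m. fps_const (fps_nth f i) * fps_X ^ i)"
  define h where "h = fps_shift (Suc m) f"
  have "f = g + fps_X ^ Suc m * h"
    by (rule fps_ext)
      (auto simp: g_def h_def fps_sum_nth fps_X_power_mult_nth if_distrib[of "(*) _"]
        simp del: power_Suc cong: if_cong)
  then have "f ^ ?p = g ^ ?p + (fps_X ^ Suc m * h) ^ ?p"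
    using assms by (simp add: freshmans_dream)
  moreover have "m < Suc m * ?p"
    using prime_gt_0_nat[OF assms] by (cases ?p) simp_all
  then have "fps_nth ((fps_X ^ Suc m * h) ^ ?p) m = 0"
    by (simp add: power_mult_distrib fps_X_power_mult_nth flip: power_mult power_Suc)
  moreover have "g ^ ?p = (\<Sum>i\<le>m. (fps_const (fps_nth f i) * fps_X ^ i) ^ ?p)"
    unfolding g_def using assms by (intro freshmans_dream_sum) simp_all
  then have "fps_nth (g ^ ?p) m =
      (\<Sum>i\<le>m. if m = i * ?p then fps_nth f i ^ ?p else 0)"
    by (simp add: fps_sum_nth power_mult_distrib if_distrib[of "(*) _"] flip: power_mult
        cong: if_cong)
  ultimately show ?thesis
    using prime_gt_0_nat[OF assms] by (auto intro!: sum.neutral)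
qed

lemma fps_nth_power2_bit:
  fixes f :: "bit fps"
  shows "fps_nth (f\<^sup>2) m = (if even m then fps_nth f (m div 2) else 0)"
  using fps_nth_power_CHAR[of f m] by (cases "fps_nth f (m div 2)") auto

subsection \<open>Hankel matrices\<close>

definition hankel_mat :: "(nat \<Rightarrow> 'a) \<Rightarrow> nat \<Rightarrow> 'a mat" where
  "hankel_mat a n = mat n n (\<lambda>(i, j). a (i + j))"

lemma hankel_mat_carrier [simp]: "hankel_mat a n \<in> carrier_mat n n"
  by (simp add: hankel_mat_def)

lemma hankel_mat_mult_vec_index:
  fixes Q :: "'a :: comm_semiring_1 poly"
  assumes "w \<in> carrier_vec n" "i < n"
    and coeff_Q: "\<And>l. coeff Q l = (if l < n then w $ (n - 1 - l) else 0)"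
  shows "(hankel_mat e n *\<^sub>v w) $ i = fps_nth (fps_of_poly Q * Abs_fps e) (n - 1 + i)"
proof -
  have "fps_nth (fps_of_poly Q * Abs_fps e) (n - 1 + i) =
      (\<Sum>l=0..n - 1 + i. coeff Q l * e (n - 1 + i - l))"
    by (simp add: fps_mult_nth)
  also have "\<dots> = (\<Sum>l<n. coeff Q l * e (n - 1 + i - l))"
    using assms(2) by (intro sum.mono_neutral_right) (auto simp: coeff_Q)
  also have "\<dots> = (\<Sum>j<n. e (i + j) * (w $ j))"
    by (rule sum.reindex_bij_witness[where i = "\<lambda>j. n - 1 - j" and j = "\<lambda>j. n - 1 - j"])
      (auto simp: coeff_Q mult.commute add.commute)
  also have "\<dots> = (hankel_mat e n *\<^sub>v w) $ i"
    using assms(1,2) by (simp add: hankel_mat_def scalar_prod_def atLeast0LessThan)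
  finally show ?thesis by simp
qed

lemma singular_hankel_mat_imp_pade_approximant:
  fixes e :: "nat \<Rightarrow> 'a :: idom"
  assumes "det (hankel_mat e n) = 0"
  obtains Q P :: "'a poly" where "Q \<noteq> 0" "degree Q < n" "degree (pCons 0 P) < n"
    "\<And>i. i < 2 * n - 1 \<Longrightarrow> fps_nth (fps_of_poly Q * Abs_fps e) i = coeff P i"
proof -
  obtain w where w: "w \<in> carrier_vec n" "w \<noteq> 0\<^sub>v n" "hankel_mat e n *\<^sub>v w = 0\<^sub>v n"
    using assms det_0_iff_vec_prod_zero[OF hankel_mat_carrier] by blast
  then have "n > 0" by (intro gr0I) auto
  define Q where "Q = truncate_fps n (Abs_fps (\<lambda>l. w $ (n - 1 - l)))"
  define P where "P = truncate_fps (n - 1) (fps_of_poly Q * Abs_fps e)"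
  have coeff_Q: "coeff Q l = (if l < n then w $ (n - 1 - l) else 0)" for l
    by (simp add: Q_def coeff_truncate_fps)
  show thesis
  proof (rule that)
    show "Q \<noteq> 0"
    proof
      assume "Q = 0"
      then have "w $ j = 0" if "j < n" for j
        using coeff_Q[of "n - 1 - j"] that by simp
      with w(1,2) show False by auto
    qed
    show "degree Q < n" using \<open>n > 0\<close> by (simp add: Q_def degree_truncate_fps)
    show "degree (pCons 0 P) < n"
      using \<open>n > 0\<close> degree_truncate_fps[of "n - 1" "fps_of_poly Q * Abs_fps e"]
      by (cases "n = 1") (auto simp: P_def)
    have gap: "fps_nth (fps_of_poly Q * Abs_fps e) (n - 1 + i) = 0" if "i < n" for i
      using hankel_mat_mult_vec_index[OF w(1) that coeff_Q, of e] w(3) that by simp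
    show "fps_nth (fps_of_poly Q * Abs_fps e) i = coeff P i" if "i < 2 * n - 1" for i
      using that gap[of "i - (n - 1)"] by (auto simp: P_def coeff_truncate_fps)
  qed
qed

lemma det_hankel_mat_Suc_diff:
  fixes a b :: "nat \<Rightarrow> 'a :: comm_ring_1"
  assumes agree: "\<And>i. i < 2 * n \<Longrightarrow> a i = b i"
  shows "det (hankel_mat a (Suc n)) - det (hankel_mat b (Suc n)) =
    (a (2 * n) - b (2 * n)) * det (hankel_mat a n)"
proof -
  let ?A = "hankel_mat a (Suc n)" and ?B = "hankel_mat b (Suc n)"
  have minors: "mat_delete ?A n j = mat_delete ?B n j" if "j \<le> n" for j
    using that by (intro eq_matI) (auto simp: mat_delete_def hankel_mat_def intro!: agree)
  have "mat_delete ?A n n = hankel_mat a n"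
    by (intro eq_matI) (auto simp: mat_delete_def hankel_mat_def)
  then have corner: "cofactor ?A n n = det (hankel_mat a n)"
    by (simp add: cofactor_def flip: mult_2)
  have "det ?A - det ?B =
      (\<Sum>j<Suc n. ?A $$ (n, j) * cofactor ?A n j) - (\<Sum>j<Suc n. ?B $$ (n, j) * cofactor ?B n j)"
    by (simp only: laplace_expansion_row[OF hankel_mat_carrier lessI])
  also have "\<dots> = (\<Sum>j<Suc n. (a (n + j) - b (n + j)) * cofactor ?A n j)"
    using minors by (simp add: sum_subtractf[symmetric] cofactor_def hankel_mat_def algebra_simps)
  also have "\<dots> = (a (2 * n) - b (2 * n)) * cofactor ?A n n"
    using agree by (simp add: mult_2)
  finally show ?thesis by (simp add: corner)
qed

subsection \<open>Nonvanishing Hankel determinants modulo 2\<close>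

lemma coeff_mult_degree_le:
  fixes p q :: "'a :: comm_semiring_0 poly"
  assumes "degree p \<le> m" "degree q \<le> n"
  shows "coeff (p * q) (m + n) = coeff p m * coeff q n"
proof (cases "degree p = m \<and> degree q = n")
  case True
  then show ?thesis by (auto simp: coeff_mult_degree_sum)
next
  case False
  then have "degree (p * q) < m + n"
    using assms degree_mult_le[of p q] by linarith
  moreover have "coeff p m = 0 \<or> coeff q n = 0"
    using False assms by (auto intro: coeff_eq_0)
  ultimately show ?thesis by (auto simp: coeff_eq_0)
qed

text \<open>With \<open>a\<close> and \<open>b\<close> the coefficients of \<open>X P\<close> and \<open>Q\<close> in degree \<open>N\<close>, the coefficient in question
  is \<open>a\<^sup>2 + a b + b\<^sup>2\<close>, which over this field vanishes only for \<open>a = b = 0\<close>.\<close>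

lemma quadratic_form_top_coeff_eq_0_imp:
  fixes P Q :: "bit poly"
  defines "R \<equiv> pCons 0 P"
  defines "N \<equiv> max (degree R) (degree Q)"
  assumes "coeff (R\<^sup>2 + R * Q + P * Q + Q\<^sup>2) (2 * N) = 0"
  shows "Q = 0"
proof -
  have le_N: "degree R \<le> N" "degree Q \<le> N" by (simp_all add: N_def)
  have "coeff (P * Q) (2 * N) = 0"
  proof (cases "P = 0")
    case False
    then have "degree (P * Q) < 2 * N"
      using le_N degree_mult_le[of P Q] by (simp add: R_def)
    then show ?thesis by (rule coeff_eq_0)
  qed simp
  then have "coeff R N * coeff R N + coeff R N * coeff Q N + coeff Q N * coeff Q N = 0"
    using assms(3) le_N by (simp add: power2_eq_square mult_2 coeff_mult_degree_le)
  then have "coeff R N = 0 \<and> coeff Q N = 0"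
    by (cases "coeff R N"; cases "coeff Q N") simp_all
  then show ?thesis
    by (cases "degree R \<le> degree Q") (auto simp: N_def max_def)
qed

lemma even_coeff_eq_0_if_recurrence:
  fixes e :: "nat \<Rightarrow> bit"
  defines "g \<equiv> Abs_fps e"
  assumes "e 0 = 1" and "\<And>k. Suc k < n \<Longrightarrow> e (2 * k + 2) = e (2 * k + 1) + e k"
    and "even m" "m < 2 * n"
  shows "fps_nth ((fps_X * g)\<^sup>2 + fps_X * g + g + 1) m = 0"
proof -
  obtain k where m: "m = 2 * k" "k < n" using assms(4,5) by (auto elim!: evenE)
  show ?thesis
  proof (cases k)
    case 0
    with m assms(2) show ?thesis by (simp add: g_def fps_nth_power2_bit)
  next
    case (Suc l)
    with m assms(3)[of l] show ?thesis by (simp add: g_def fps_nth_power2_bit)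
  qed
qed

lemma even_coeff_power2_mult_eq_0:
  fixes q h :: "bit fps"
  assumes "\<And>i. even i \<Longrightarrow> i \<le> m \<Longrightarrow> fps_nth h i = 0" and "even m"
  shows "fps_nth (q\<^sup>2 * h) m = 0"
proof -
  have "fps_nth (q\<^sup>2) i * fps_nth h (m - i) = 0" if "i \<le> m" for i
    using assms that by (cases "even i") (simp_all add: fps_nth_power2_bit)
  then show ?thesis unfolding fps_mult_nth by (intro sum.neutral) auto
qed

text \<open>The recurrence says that \<open>h = X\<^sup>2 g\<^sup>2 + X g + g + 1\<close>, where \<open>g = \<Sum>k. e k X\<^sup>k\<close>, has no even
  powers of degree below \<open>2 n\<close>. Multiplying by the even series \<open>Q\<^sup>2\<close> transfers this to the quadratic
  form in \<open>Q g\<close> and \<open>Q\<close>, and \<open>Q g\<close> agrees with the polynomial \<open>P\<close> of a Pade approximant in all relevant degrees.\<close>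

lemma det_hankel_mat_bit_if_recurrence:
  fixes e :: "nat \<Rightarrow> bit"
  assumes "e 0 = 1" and "\<And>k. Suc k < n \<Longrightarrow> e (2 * k + 2) = e (2 * k + 1) + e k"
  shows "det (hankel_mat e n) = 1"
proof (rule ccontr)
  assume "det (hankel_mat e n) \<noteq> 1"
  then have singular: "det (hankel_mat e n) = 0" by simp
  obtain Q P where "Q \<noteq> 0" and degs: "degree Q < n" "degree (pCons 0 P) < n"
    and approx: "\<And>i. i < 2 * n - 1 \<Longrightarrow> fps_nth (fps_of_poly Q * Abs_fps e) i = coeff P i"
    using singular_hankel_mat_imp_pade_approximant[OF singular] by blast
  define g where "g = Abs_fps e"
  define h where "h = (fps_X * g)\<^sup>2 + fps_X * g + g + 1"
  define q where "q = fps_of_poly Q"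
  define r where "r = fps_of_poly P"
  define N where "N = max (degree (pCons 0 P)) (degree Q)"
  have N: "2 * N < 2 * n - 1" using degs by (auto simp: N_def)
  define F where "F = (pCons 0 P)\<^sup>2 + pCons 0 P * Q + P * Q + Q\<^sup>2"
  have "fps_of_poly F = (fps_X * r)\<^sup>2 + fps_X * r * q + r * q + q\<^sup>2"
    by (simp add: F_def q_def r_def fps_of_poly_add fps_of_poly_mult fps_of_poly_power mult.commute)
  then have difference: "q\<^sup>2 * h - fps_of_poly F =
      (q * g - r) * (fps_X\<^sup>2 * (q * g + r) + fps_X * q + q)"
    by (simp add: h_def algebra_simps power2_eq_square)
  have "fps_nth (q\<^sup>2 * h - fps_of_poly F) (2 * N) = 0"
    unfolding difference fps_mult_nth
    using approx N by (intro sum.neutral) (auto simp: q_def g_def r_def)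
  moreover have "fps_nth (q\<^sup>2 * h) (2 * N) = 0"
    unfolding h_def g_def using assms N
    by (intro even_coeff_power2_mult_eq_0 even_coeff_eq_0_if_recurrence[where n = n]) auto
  ultimately have "coeff F (2 * N) = 0" by simp
  then have "Q = 0" unfolding F_def N_def by (rule quadratic_form_top_coeff_eq_0_imp)
  with \<open>Q \<noteq> 0\<close> show False by simp
qed

lemma all_det_hankel_mat_bit_iff_recurrence:
  fixes e :: "nat \<Rightarrow> bit"
  shows "(\<forall>n. det (hankel_mat e n) = 1) \<longleftrightarrow>
    e 0 = 1 \<and> (\<forall>k. e (2 * k + 2) = e (2 * k + 1) + e k)"
proof
  assume nonzero: "\<forall>n. det (hankel_mat e n) = 1"
  have "det (hankel_mat e 1) = e 0"
    by (subst det_single) (auto simp: hankel_mat_def)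
  then have e_0: "e 0 = 1" using nonzero by metis
  have "e (2 * k + 2) = e (2 * k + 1) + e k" for k
  proof (induction k rule: less_induct)
    case (less k)
    define e' where "e' = e(2 * k + 2 := e (2 * k + 1) + e k)"
    have "det (hankel_mat e' (Suc (Suc k))) = 1"
    proof (rule det_hankel_mat_bit_if_recurrence)
      show "e' 0 = 1" by (simp add: e'_def e_0)
      show "e' (2 * l + 2) = e' (2 * l + 1) + e' l" if "Suc l < Suc (Suc k)" for l
        using that less.IH[of l] by (cases "l = k") (auto simp: e'_def)
    qed
    moreover have "det (hankel_mat e (Suc (Suc k))) - det (hankel_mat e' (Suc (Suc k))) =
        (e (2 * Suc k) - e' (2 * Suc k)) * det (hankel_mat e (Suc k))"
      by (rule det_hankel_mat_Suc_diff) (auto simp: e'_def)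
    ultimately have "e (2 * Suc k) - e' (2 * Suc k) = 0"
      using nonzero by (metis diff_self mult_1_right)
    then show ?case by (simp only: right_minus_eq) (simp add: e'_def)
  qed
  with e_0 show "e 0 = 1 \<and> (\<forall>k. e (2 * k + 2) = e (2 * k + 1) + e k)" by simp
qed (auto intro: det_hankel_mat_bit_if_recurrence)

subsection \<open>Hankel determinants of sign sequences\<close>

lemma det_scale_rows:
  fixes a :: "nat \<Rightarrow> nat \<Rightarrow> 'a :: comm_ring_1"
  shows "det (mat n n (\<lambda>(i, j). c i * a i j)) = (\<Prod>i<n. c i) * det (mat n n (\<lambda>(i, j). a i j))"
proof -
  have rows: "mat n n (\<lambda>(i, j). b i j) = mat\<^sub>r n n (\<lambda>i. vec n (b i))" for b :: "nat \<Rightarrow> nat \<Rightarrow> 'a"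
    by (rule eq_matI) auto
  have "mat n n (\<lambda>(i, j). c i * a i j) = mat\<^sub>r n n (\<lambda>i. c i \<cdot>\<^sub>v vec n (a i))"
    by (rule eq_matI) auto
  then show ?thesis
    using det_rows_mul[of "\<lambda>i. vec n (a i)" n c] by (simp add: rows atLeast0LessThan)
qed

lemma det_row_differences:
  fixes a :: "nat \<Rightarrow> nat \<Rightarrow> 'a :: comm_ring_1"
  shows "det (mat n n (\<lambda>(i, j). if Suc i < n then a i j - a (Suc i) j else a i j)) =
    det (mat n n (\<lambda>(i, j). a i j))"
    (is "det ?D = _")
proof -
  define A where "A = mat n n (\<lambda>(i, j). a i j)"
  define L :: "'a mat" where
    "L = mat n n (\<lambda>(i, j). if j = i then 1 else if j = Suc i then -1 else 0)"
  have carrier: "L \<in> carrier_mat n n" "A \<in> carrier_mat n n"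
    by (auto simp: L_def A_def)
  have "L * A = ?D"
  proof (rule eq_matI)
    fix i j assume "i < dim_row ?D" "j < dim_col ?D"
    then have ij: "i < n" "j < n" by auto
    then have "(L * A) $$ (i, j) =
        (\<Sum>k<n. (if k = i then 1 else if k = Suc i then -1 else 0) * a k j)"
      by (simp add: L_def A_def scalar_prod_def atLeast0LessThan)
    also have "\<dots> = (\<Sum>k<n. (if k = i then a k j else 0) - (if k = Suc i then a k j else 0))"
      by (intro sum.cong) auto
    also have "\<dots> = (if Suc i < n then a i j - a (Suc i) j else a i j)"
      using ij by (simp add: sum_subtractf)
    finally show "(L * A) $$ (i, j) = ?D $$ (i, j)"
      using ij by simp
  qed (simp_all add: L_def A_def)
  moreover have "det L = prod_list (diag_mat L)"
    by (rule det_upper_triangular[OF _ carrier(1)]) (auto simp: L_def)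
  moreover have "diag_mat L = replicate n 1"
    by (rule nth_equalityI) (auto simp: diag_mat_def L_def)
  ultimately show ?thesis
    using det_mult[OF carrier] by (simp add: A_def)
qed

lemma det_col_differences:
  fixes a :: "nat \<Rightarrow> nat \<Rightarrow> 'a :: comm_ring_1"
  shows "det (mat n n (\<lambda>(i, j). if Suc j < n then a i j - a i (Suc j) else a i j)) =
    det (mat n n (\<lambda>(i, j). a i j))"
proof -
  have transposed: "det (mat n n (\<lambda>(i, j). b i j)) = det (mat n n (\<lambda>(i, j). b j i))"
    for b :: "nat \<Rightarrow> nat \<Rightarrow> 'a"
  proof -
    have "(mat n n (\<lambda>(i, j). b i j))\<^sup>T = mat n n (\<lambda>(i, j). b j i)"
      by (rule eq_matI) auto
    then show ?thesis by (metis det_transpose mat_carrier)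
  qed
  show ?thesis
    using det_row_differences[of n "\<lambda>i j. a j i"]
      transposed[of a] transposed[of "\<lambda>i j. if Suc j < n then a i j - a i (Suc j) else a i j"]
    by simp
qed

lemma det_hankel_last_row_1:
  fixes f :: "nat \<Rightarrow> 'a :: comm_ring_1"
  shows "det (mat (Suc m) (Suc m) (\<lambda>(i, j). if i < m then f (i + j) else 1)) =
    det (hankel_mat (\<lambda>k. f k - f (Suc k)) m)"
proof -
  define a where "a i j = (if i < m then f (i + j) else 1)" for i j
  define B where
    "B = mat (Suc m) (Suc m) (\<lambda>(i, j). if Suc j < Suc m then a i j - a i (Suc j) else a i j)"
  have B: "B \<in> carrier_mat (Suc m) (Suc m)" by (simp add: B_def)
  have "det (mat (Suc m) (Suc m) (\<lambda>(i, j). a i j)) = det B"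
    unfolding B_def by (rule det_col_differences[symmetric])
  also have "\<dots> = (\<Sum>j<Suc m. B $$ (m, j) * cofactor B m j)"
    by (rule laplace_expansion_row[OF B]) simp
  also have "\<dots> = cofactor B m m"
    by (simp add: B_def a_def)
  also have "\<dots> = det (mat_delete B m m)"
    by (simp add: cofactor_def)
  also have "mat_delete B m m = hankel_mat (\<lambda>k. f k - f (Suc k)) m"
    by (rule eq_matI) (auto simp: mat_delete_def B_def a_def hankel_mat_def)
  finally show ?thesis by (simp add: a_def)
qed

lemma hankel_det_div_pow2:
  assumes "\<And>n. d n \<in> {-1, 1}"
  shows "hankel_det d (Suc m) div 2 ^ m = det (mat (Suc m) (Suc m)
    (\<lambda>(i, j). if i < m then (d (i + j) - d (Suc (i + j))) div 2 else d (i + j)))"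
    (is "_ = det ?B")
proof -
  have halve: "2 * ((d i - d j) div 2) = d i - d j" for i j
    using assms[of i] assms[of j] by auto
  have "hankel_det d (Suc m) = det (mat (Suc m) (Suc m)
      (\<lambda>(i, j). if Suc i < Suc m then d (i + j) - d (Suc i + j) else d (i + j)))"
    unfolding hankel_det_def by (rule det_row_differences[symmetric])
  also have "\<dots> = det (mat (Suc m) (Suc m) (\<lambda>(i, j). (if i < m then 2 else 1) *
      (if i < m then (d (i + j) - d (Suc (i + j))) div 2 else d (i + j))))"
    by (intro arg_cong[of _ _ det] eq_matI) (auto simp: halve)
  also have "\<dots> = (\<Prod>i<Suc m. if i < m then 2 else 1) * det ?B"
    by (rule det_scale_rows)
  finally show ?thesis by simp
qed

lemma of_int_hankel_det_div_pow2:
  assumes "\<And>n. d n \<in> {-1, 1}"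
  shows "(of_int (hankel_det d (Suc m) div 2 ^ m) :: bit) =
    det (hankel_mat (\<lambda>k. of_bool (d k \<noteq> d (k + 2))) m)"
proof -
  define f :: "nat \<Rightarrow> bit" where "f k = of_bool (d k \<noteq> d (Suc k))" for k
  let ?B = "mat (Suc m) (Suc m)
    (\<lambda>(i, j). if i < m then (d (i + j) - d (Suc (i + j))) div 2 else d (i + j))"
  have half: "of_int ((d k - d (Suc k)) div 2) = f k" for k
    using assms[of k] assms[of "Suc k"] by (auto simp: f_def)
  have unit: "of_int (d k) = (1 :: bit)" for k
    using assms[of k] by auto
  have "of_int (hankel_det d (Suc m) div 2 ^ m) = det (map_mat of_int ?B :: bit mat)"
    using assms by (simp add: hankel_det_div_pow2)
  also have "map_mat of_int ?B = mat (Suc m) (Suc m) (\<lambda>(i, j). if i < m then f (i + j) else 1)"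
    by (rule eq_matI) (auto simp: half unit)
  also have "det \<dots> = det (hankel_mat (\<lambda>k. f k - f (Suc k)) m)"
    by (rule det_hankel_last_row_1)
  also have "(\<lambda>k. f k - f (Suc k)) = (\<lambda>k. of_bool (d k \<noteq> d (k + 2)))"
  proof
    show "f k - f (Suc k) = of_bool (d k \<noteq> d (k + 2))" for k
      using assms[of k] assms[of "Suc k"] assms[of "k + 2"] by (auto simp: f_def)
  qed
  finally show ?thesis .
qed

definition quad_prod :: "(nat \<Rightarrow> int) \<Rightarrow> nat \<Rightarrow> int" where
  "quad_prod d n = d n * d (n + 1) * d (2 * n + 1) * d (2 * n + 2)"

lemma recurrence_iff_quad_prod_Suc:
  fixes d :: "nat \<Rightarrow> int"
  assumes sign: "\<And>n. d n \<in> {-1, 1}"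
  defines "e \<equiv> \<lambda>k. of_bool (d k \<noteq> d (k + 2)) :: bit"
  shows "e (2 * k + 2) = e (2 * k + 1) + e k \<longleftrightarrow> quad_prod d (Suc k) = quad_prod d k"
proof -
  have idx: "2 * k + 2 + 2 = 2 * Suc k + 2" "2 * k + 1 + 2 = 2 * Suc k + 1" "k + 2 = Suc k + 1"
    "k + 1 = Suc k"
    by auto
  show ?thesis
    unfolding e_def quad_prod_def idx
    using sign[of k] sign[of "Suc k"] sign[of "Suc k + 1"] sign[of "2 * k + 1"]
      sign[of "2 * k + 2"] sign[of "2 * Suc k + 1"] sign[of "2 * Suc k + 2"]
    by (elim insertE emptyE) simp_all
qed

lemma apwenian_iff_quad_prod:
  assumes sign: "\<And>n. d n \<in> {-1, 1}"
  shows "apwenian d \<longleftrightarrow> (\<forall>n. quad_prod d n = -1)"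
proof -
  define e :: "nat \<Rightarrow> bit" where "e k = of_bool (d k \<noteq> d (k + 2))" for k
  have shift: "(\<forall>n\<ge>1. P n) \<longleftrightarrow> (\<forall>m. P (Suc m))" for P
    by (metis One_nat_def Suc_le_D le_add1 plus_1_eq_Suc)
  have "apwenian d \<longleftrightarrow> (\<forall>m. [hankel_det d (Suc m) div 2 ^ m = 1] (mod 2))"
    unfolding apwenian_def shift using sign by simp
  also have "\<dots> \<longleftrightarrow> (\<forall>m. (of_int (hankel_det d (Suc m) div 2 ^ m) :: bit) = of_int 1)"
    by (simp only: of_int_eq_iff_cong_CHAR CHAR_bit of_nat_numeral)
  also have "\<dots> \<longleftrightarrow> (\<forall>m. det (hankel_mat e m) = 1)"
    by (simp add: of_int_hankel_det_div_pow2[OF sign] e_def[abs_def])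
  also have "\<dots> \<longleftrightarrow> e 0 = 1 \<and> (\<forall>k. e (2 * k + 2) = e (2 * k + 1) + e k)"
    by (rule all_det_hankel_mat_bit_iff_recurrence)
  also have "e 0 = 1 \<longleftrightarrow> quad_prod d 0 = -1"
    using sign[of 0] sign[of 1] sign[of 2] by (auto simp: e_def quad_prod_def numeral_2_eq_2)
  also have "(\<forall>k. e (2 * k + 2) = e (2 * k + 1) + e k) \<longleftrightarrow>
      (\<forall>k. quad_prod d (Suc k) = quad_prod d k)"
    unfolding e_def using recurrence_iff_quad_prod_Suc[of d, OF sign] by blast
  also have "quad_prod d 0 = -1 \<and> (\<forall>k. quad_prod d (Suc k) = quad_prod d k) \<longleftrightarrow>
      (\<forall>n. quad_prod d n = -1)"
  proof (intro iffI allI)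
    show "quad_prod d n = -1"
      if "quad_prod d 0 = -1 \<and> (\<forall>k. quad_prod d (Suc k) = quad_prod d k)" for n
      using that by (induction n) simp_all
  qed simp
  finally show ?thesis .
qed

lemma quad_prod_eq_minus_1_iff_cong:
  assumes sign: "\<And>n. d n \<in> {-1, 1}"
  shows "quad_prod d n = -1 \<longleftrightarrow>
    [(d n + d (n + 1) - d (2 * n + 1) - d (2 * n + 2)) div 2 = 1] (mod 2)"
  using sign[of n] sign[of "n + 1"] sign[of "2 * n + 1"] sign[of "2 * n + 2"]
  unfolding quad_prod_def by (elim insertE emptyE) (simp_all add: cong_def)

subsection \<open>Thue-Morse sequences\<close>

lemma thue_morse_imp_quad_prod:
  assumes "thue_morse d" and sign: "\<And>n. d n \<in> {-1, 1}"
  shows "quad_prod d n = -1"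
proof -
  have "d (2 * (n + 1)) = d (n + 1)" "d (2 * n + 1) = - d n"
    using assms(1) unfolding thue_morse_def by blast+
  then show ?thesis
    using sign[of n] sign[of "n + 1"] by (auto simp: quad_prod_def)
qed

lemma four_mult_add_2_if_constant_pairs:
  assumes sign: "\<And>n. d n \<in> {-1, 1}" and quad: "\<And>n. quad_prod d n = -1"
    and pair: "\<And>m. d (2 * m + 1) = \<kappa> * d (2 * m)"
  shows "d (4 * m + 2) = - d (4 * m)"
proof -
  have "d (2 * m + 1) = \<kappa> * d (2 * m)" "d (4 * m + 1) = \<kappa> * d (4 * m)"
    using pair[of m] pair[of "2 * m"] by simp_all
  then show ?thesis
    using quad[of "2 * m"] sign[of "2 * m"] sign[of "2 * m + 1"] sign[of "4 * m"]
      sign[of "4 * m + 1"] sign[of "4 * m + 2"]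
    by (auto simp: quad_prod_def)
qed

lemma four_mult_if_constant_pairs:
  assumes sign: "\<And>n. d n \<in> {-1, 1}" and quad: "\<And>n. quad_prod d n = -1"
    and pair: "\<And>m. d (2 * m + 1) = \<kappa> * d (2 * m)"
  shows "d (4 * m) = d (2 * m)"
proof (induction m)
  case (Suc m)
  have idx: "2 * (2 * m + 1) = 4 * m + 2" "4 * m + 2 + 1 = 4 * m + 3" "4 * m + 2 + 2 = 4 * Suc m"
    "2 * m + 1 + 1 = 2 * Suc m"
    by simp_all
  have "d (4 * m + 3) = - \<kappa> * d (4 * m)"
    using pair[of "2 * m + 1"] four_mult_add_2_if_constant_pairs[OF assms, of m]
    unfolding idx by simp
  then show ?case
    using quad[of "2 * m + 1"] pair[of m] Suc.IH sign[of "2 * m"] sign[of "2 * m + 1"]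
      sign[of "2 * Suc m"] sign[of "4 * m + 3"] sign[of "4 * Suc m"]
    unfolding quad_prod_def idx by auto
qed simp

lemma thue_morse_if_alternating_pairs:
  assumes "\<And>n. d n \<in> {-1, 1}" "\<And>n. quad_prod d n = -1" "d 0 = 1"
    and pair: "\<And>m. d (2 * m + 1) = - d (2 * m)"
  shows "thue_morse d"
proof -
  have minus_pair: "d (2 * m + 1) = - 1 * d (2 * m)" for m
    using pair by simp
  have "d (2 * n) = d n" for n
  proof (cases "even n")
    case True
    then show ?thesis
      using four_mult_if_constant_pairs[OF assms(1,2) minus_pair] by (auto elim!: evenE)
  next
    case False
    then obtain k where "n = 2 * k + 1" by (elim oddE)
    then show ?thesis
      using four_mult_add_2_if_constant_pairs[OF assms(1,2) minus_pair, of k]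
        four_mult_if_constant_pairs[OF assms(1,2) minus_pair, of k] pair[of k]
      by simp
  qed
  then show ?thesis using assms(3) pair by (simp add: thue_morse_def)
qed

subsection \<open>Fixed points of sign substitutions\<close>

lemma fixed_point_nth:
  assumes "p > 0" "\<And>n. length (\<sigma> (d n)) = p" "fixed_point \<sigma> d"
  shows "d n = \<sigma> (d (n div p)) ! (n mod p)"
proof -
  have "flat (smap \<sigma> (smap d nats)) !! n = smap \<sigma> (smap d nats) !! (n div p) ! (n mod p)"
    using assms(1,2) by (intro flat_constant_length) (auto simp: stream.set_map)
  then show ?thesis using assms(3) by (simp add: fixed_point_def)
qed

locale sign_substitution =
  fixes p :: nat and v d :: "nat \<Rightarrow> int"
  assumes two_le_p: "2 \<le> p"
    and v_mod: "v (i mod p) = v i"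
    and d_sign: "d n \<in> {-1, 1}"
    and d_eq: "d n = d (n div p) * v n"
begin

lemma v_sign: "v i \<in> {-1, 1}"
  using d_eq[of i] d_sign[of i] d_sign[of "i div p"] by auto

lemma v_cong: "i mod p = j mod p \<Longrightarrow> v i = v j"
  by (metis v_mod)

lemma d_block: "j < p \<Longrightarrow> d (n * p + j) = d n * v j"
  using d_eq[of "n * p + j"] v_cong[of "n * p + j" j] by simp

lemma d_mult_p: "d (n * p) = d n"
proof -
  have "v 0 = 1" using d_eq[of 0] d_sign[of 0] by auto
  then show ?thesis using d_block[of 0 n] two_le_p by simp
qed

lemma consecutive_product:
  assumes "\<not> p dvd Suc n"
  shows "d n * d (Suc n) = v n * v (Suc n)"
proof -
  have "Suc n div p = n div p" using assms by (simp add: div_Suc dvd_eq_mod_eq_0)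
  then have "d n * d (Suc n) = (d (n div p) * v n) * (d (n div p) * v (Suc n))"
    using d_eq[of n] d_eq[of "Suc n"] by simp
  then show ?thesis using d_sign[of "n div p"] by auto
qed

lemma quad_prod_v_mod: "quad_prod v (n mod p) = quad_prod v n"
proof -
  have "v (n mod p + b) = v (n + b)" "v (2 * (n mod p) + b) = v (2 * n + b)" for b
    by (intro v_cong; metis mod_add_left_eq mod_mult_right_eq)+
  then show ?thesis by (simp only: quad_prod_def v_mod)
qed

lemma quad_prod_d_eq_quad_prod_v:
  assumes "odd p" "\<not> p dvd Suc n"
  shows "quad_prod d n = quad_prod v n"
proof -
  have "coprime p 2" using assms(1) by simp
  then have "\<not> p dvd 2 * Suc n"
    using assms(2) by (simp add: coprime_dvd_mult_right_iff del: mult_Suc_right)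
  then have "\<not> p dvd Suc (2 * n + 1)" by simp
  then show ?thesis
    using consecutive_product[of n] consecutive_product[of "2 * n + 1"] assms(2)
    by (simp add: quad_prod_def mult.assoc)
qed

lemma quad_prod_d_div_if_dvd_Suc:
  assumes "p dvd Suc n"
  shows "quad_prod d n = quad_prod d (n div p)"
proof -
  define m where "m = n div p"
  have "n mod p = p - 1"
    using assms two_le_p by (simp add: dvd_eq_mod_eq_0 mod_Suc split: if_splits)
  then have n: "n = m * p + (p - 1)" unfolding m_def by (metis div_mult_mod_eq)
  have idx: "n + 1 = (m + 1) * p" "2 * n + 1 = (2 * m + 1) * p + (p - 1)"
    "2 * n + 2 = (2 * m + 2) * p"
    using n two_le_p by (auto simp: algebra_simps)
  have "d n = d m * v (p - 1)"
    unfolding n by (rule d_block) (use two_le_p in simp)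
  moreover have "d (2 * n + 1) = d (2 * m + 1) * v (p - 1)"
    unfolding idx by (rule d_block) (use two_le_p in simp)
  moreover have "d (n + 1) = d (m + 1)" "d (2 * n + 2) = d (2 * m + 2)"
    unfolding idx by (rule d_mult_p)+
  ultimately have "quad_prod d n = quad_prod d m * (v (p - 1) * v (p - 1))"
    by (simp only: quad_prod_def ac_simps)
  then show ?thesis
    using v_sign[of "p - 1"] by (auto simp: m_def)
qed

lemma all_quad_prod_d_iff_if_odd:
  assumes "odd p"
  shows "(\<forall>n. quad_prod d n = -1) \<longleftrightarrow> (\<forall>j\<le>p - 2. quad_prod v j = -1)"
proof
  assume "\<forall>n. quad_prod d n = -1"
  moreover have "\<not> p dvd Suc j" if "j \<le> p - 2" for j
    using that two_le_p by (auto dest: dvd_imp_le)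
  ultimately show "\<forall>j\<le>p - 2. quad_prod v j = -1"
    using quad_prod_d_eq_quad_prod_v[OF assms] by metis
next
  assume first_block: "\<forall>j\<le>p - 2. quad_prod v j = -1"
  have "quad_prod d n = -1" for n
  proof (induction n rule: less_induct)
    case (less n)
    show ?case
    proof (cases "p dvd Suc n")
      case True
      then have "n > 0" using two_le_p by (intro gr0I) auto
      then have "n div p < n" using two_le_p by simp
      with less.IH quad_prod_d_div_if_dvd_Suc[OF True] show ?thesis by metis
    next
      case False
      then have "n mod p \<noteq> p - 1"
        using two_le_p by (auto simp: dvd_eq_mod_eq_0 mod_Suc)
      moreover have "n mod p < p" using two_le_p by simp
      ultimately have "n mod p \<le> p - 2" by linarith
      with first_block show ?thesis
        using quad_prod_d_eq_quad_prod_v[OF assms False] quad_prod_v_mod[of n] by metis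
    qed
  qed
  then show "\<forall>n. quad_prod d n = -1" by blast
qed

lemma constant_pairs_if_even:
  assumes "even p" and quad: "\<And>n. quad_prod d n = -1"
  shows "\<exists>\<kappa>. \<forall>m. d (2 * m + 1) = \<kappa> * d (2 * m)"
proof -
  obtain s where s: "p = 2 * s" "s \<ge> 1" using assms(1) two_le_p by (auto elim: evenE)
  have less_p: "s - 1 < p" "s < p" "p - 1 < p" using s by auto
  define \<kappa> where "\<kappa> = - (v (s - 1) * v s * v (p - 1))"
  have "d (2 * m + 1) = \<kappa> * d (2 * m)" for m
  proof -
    \<comment> \<open>For this \<open>n\<close> the letters at \<open>2 n + 1\<close> and \<open>2 n + 2\<close> straddle two blocks.\<close>
    define n where "n = m * p + (s - 1)"
    have idx: "n + 1 = m * p + s" "2 * n + 1 = (2 * m) * p + (p - 1)"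
      "2 * n + 2 = (2 * m + 1) * p"
      using s by (auto simp: n_def algebra_simps)
    have "d n = d m * v (s - 1)"
      unfolding n_def using less_p by (intro d_block)
    moreover have "d (n + 1) = d m * v s" "d (2 * n + 1) = d (2 * m) * v (p - 1)"
      "d (2 * n + 2) = d (2 * m + 1)"
      unfolding idx using less_p by (auto simp only: d_block d_mult_p)
    ultimately have "(d m * v (s - 1)) * (d m * v s) * (d (2 * m) * v (p - 1)) * d (2 * m + 1) = -1"
      using quad[of n] by (simp add: quad_prod_def)
    then show ?thesis
      using d_sign[of m] d_sign[of "2 * m"] d_sign[of "2 * m + 1"] v_sign[of "s - 1"] v_sign[of s]
        v_sign[of "p - 1"]
      unfolding \<kappa>_def by (elim insertE emptyE) simp_all
  qed
  then show ?thesis by blast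
qed

lemma all_quad_prod_d_iff_if_even:
  assumes "even p" "d 0 = 1"
  shows "(\<forall>n. quad_prod d n = -1) \<longleftrightarrow> thue_morse d"
proof
  assume "\<forall>n. quad_prod d n = -1"
  then have quad: "quad_prod d n = -1" for n by blast
  obtain \<kappa> where pair: "\<And>m. d (2 * m + 1) = \<kappa> * d (2 * m)"
    using constant_pairs_if_even[OF assms(1) quad] by blast
  obtain s where s: "p = 2 * s" using assms(1) by (elim evenE)
  have "d 1 = d p" "d 2 = d (2 * p)"
    using d_mult_p[of 1] d_mult_p[of 2] by simp_all
  moreover have "d (4 * s) = d (2 * s)"
    by (rule four_mult_if_constant_pairs[OF d_sign quad pair])
  moreover have "d 2 = -1"
    using four_mult_add_2_if_constant_pairs[OF d_sign quad pair, of 0] assms(2)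
    by (simp add: numeral_2_eq_2)
  ultimately have "\<kappa> = -1" using pair[of 0] s assms(2) by simp
  with pair show "thue_morse d"
    by (intro thue_morse_if_alternating_pairs d_sign quad assms(2)) simp
next
  assume "thue_morse d"
  then show "\<forall>n. quad_prod d n = -1"
    using thue_morse_imp_quad_prod[of d, OF _ d_sign] by blast
qed

end

theorem theorem5p2:
  fixes p :: nat and v :: "nat \<Rightarrow> int" and \<sigma> :: "int \<Rightarrow> int list" and d :: "nat \<Rightarrow> int"
  assumes "p \<ge> 2"
    and "v 0 = 1"
    and "\<And>i. i < p \<Longrightarrow> v i \<in> {-1, 1}"
    and "\<And>n j. j < p \<Longrightarrow> v (n * p + j) = v j"
    and "\<sigma> 1 = map v [0..<p]"
    and "\<sigma> (-1) = map (\<lambda>i. - v i) [0..<p]"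
    and "\<And>n. d n \<in> {-1, 1}"
    and "fixed_point \<sigma> d"
    and "d 0 = 1"
  shows "(odd p \<longrightarrow>
            (apwenian d \<longleftrightarrow>
              (\<forall>j\<le>p - 2. [(v j + v (j + 1) - v (2 * j + 1) - v (2 * j + 2)) div 2 = 1] (mod 2)))) \<and>
         (even p \<longrightarrow> (apwenian d \<longleftrightarrow> thue_morse d))"
proof -
  have v_mod: "v (i mod p) = v i" for i
    using assms(4)[of "i mod p" "i div p"] assms(1) by simp
  have \<sigma>_word: "length (\<sigma> x) = p" "j < p \<Longrightarrow> \<sigma> x ! j = x * v j" if "x \<in> {-1, 1}" for x j
    using that assms(5,6) by auto
  have d_eq: "d n = d (n div p) * v n" for n
    using fixed_point_nth[of p \<sigma> d n] \<sigma>_word[OF assms(7)] assms(1,8) by (simp add: v_mod)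
  interpret sign_substitution p v d
    using assms(1,7) v_mod d_eq by unfold_locales
  show ?thesis
    using all_quad_prod_d_iff_if_odd all_quad_prod_d_iff_if_even assms(9)
    by (simp add: apwenian_iff_quad_prod[OF d_sign] quad_prod_eq_minus_1_iff_cong[OF v_sign])
qed

end
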